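(* Let $u_1,\dots,u_K\in\mathbb K$ be fixed points. The map $$\tilde L(u)\mapsto\sum_{k=1}^K\frac{M_ku_k}{u-u_k},$$ where the family $(M_1,\dots,M_K)$ generates the Lie algebra $\mathfrak g=gl(N)^{\oplus K}$, defines a Lie algebra morphism $\mathfrak G_{trig}\to\mathfrak g$ and, consequently, a morphism of the enveloping algebras of these Lie algebras.
   Context: Ground field $\mathbb K=\mathbb C$ or $\mathbb R$. $\mathfrak G_{trig}$ is the Lie algebra with basis $\tilde l_i^j[k]$ ($k\ge1$, $1\le i,j\le N$), the entries of the coefficients $\tilde L[k]=\|\tilde l_i^j[k]\|$ of $\tilde L(u)=\sum_{k\ge1}\tilde L[k]u^{-k}$, with bracket $$[\tilde L_1(u),\tilde L_2(v)]=\Big[P,\frac{u\tilde L_1(u)-v\tilde L_1(v)}{u-v}\Big],$$ where $\tilde L_1=\tilde L\otimes I$, $\tilde L_2=I\otimes\tilde L$, $P$ is the flip on $V^{\otimes2}$ with $\dim V=N$, and the identity is understood coefficientwise in $u^{-1},v^{-1}$ (lower index = row, upper index = column of matrices). "The family $(M_1,\dots,M_K)$ generates $gl(N)^{\oplus K}$" means: each $M_k=\|(m_k)_i^j\|$ is the $N\times N$ generating matrix of a copy of $gl(N)$, with $[m_i^j,m_r^s]=\delta_r^jm_i^s-\delta_i^sm_r^j$ for the entries of one matrix, and the entries of any two different matrices of the family commute with each other. The fractions $\frac{1}{u-u_k}$ are expanded in powers of $u^{-1}$. *)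

theory Defs
  imports
    "HOL-Analysis.Finite_Cartesian_Product"
    "HOL-Computational_Algebra.Formal_Laurent_Series"
    "HOL-Library.Poly_Mapping"
    "HOL-Algebra.QuotRing"
begin

no_notation fps_nth (infixl "$" 75)

section \<open>Lie algebras and their enveloping algebras\<close>

definition (in vector_space) basis_family :: "('i \<Rightarrow> 'b) \<Rightarrow> 'i set \<Rightarrow> bool"
  where "basis_family f I \<longleftrightarrow> inj_on f I \<and> independent (f ` I) \<and> span (f ` I) = UNIV"

locale lie_algebra = vector_space smul
  for smul :: "'k::field \<Rightarrow> 'g::ab_group_add \<Rightarrow> 'g" +
  fixes bracket :: "'g \<Rightarrow> 'g \<Rightarrow> 'g"
  assumes bracket_add_left: "bracket (x + y) z = bracket x z + bracket y z"
    and bracket_add_right: "bracket x (y + z) = bracket x y + bracket x z"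
    and bracket_scale_left: "bracket (smul c x) y = smul c (bracket x y)"
    and bracket_scale_right: "bracket x (smul c y) = smul c (bracket x y)"
    and bracket_self: "bracket x x = 0"
    and jacobi: "bracket x (bracket y z) + bracket y (bracket z x) + bracket z (bracket x y) = 0"

definition lie_algebra_hom ::
  "('k::field \<Rightarrow> 'g::ab_group_add \<Rightarrow> 'g) \<Rightarrow> ('g \<Rightarrow> 'g \<Rightarrow> 'g) \<Rightarrow>
   ('k \<Rightarrow> 'h::ab_group_add \<Rightarrow> 'h) \<Rightarrow> ('h \<Rightarrow> 'h \<Rightarrow> 'h) \<Rightarrow> ('g \<Rightarrow> 'h) \<Rightarrow> bool"
  where "lie_algebra_hom s br s' br' f \<longleftrightarrow>
    Vector_Spaces.linear s s' f \<and> (\<forall>x y. f (br x y) = br' (f x) (f y))"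

datatype 'g word = Word (letters: "'g list")

instantiation word :: (type) monoid_add
begin
definition "0 = Word []"
definition "v + w = Word (letters v @ letters w)"
instance
  by standard (simp_all add: zero_word_def plus_word_def)
end

text \<open>With the free monoid written additively, the convolution product makes
  \<^typ>\<open>'g word \<Rightarrow>\<^sub>0 'k\<close> the free associative unital algebra on the underlying set of
  \<^typ>\<open>'g\<close>.\<close>

definition free_algebra :: "('g word \<Rightarrow>\<^sub>0 'k::field) ring"
  where "free_algebra = \<lparr>carrier = UNIV, mult = (*), one = 1, zero = 0, add = (+)\<rparr>"

definition free_gen :: "'g \<Rightarrow> ('g word \<Rightarrow>\<^sub>0 'k::field)"
  where "free_gen x = Poly_Mapping.single (Word [x]) 1"

definition free_const :: "'k \<Rightarrow> ('g word \<Rightarrow>\<^sub>0 'k::field)"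
  where "free_const c = Poly_Mapping.single 0 c"

text \<open>The first two families of relations make the quotient the tensor algebra of the vector
  space; the third one imposes $xy - yx = [x,y]$.\<close>

definition uea_relations ::
  "('k::field \<Rightarrow> 'g::ab_group_add \<Rightarrow> 'g) \<Rightarrow> ('g \<Rightarrow> 'g \<Rightarrow> 'g) \<Rightarrow> ('g word \<Rightarrow>\<^sub>0 'k) set"
  where "uea_relations smul bracket =
    {free_gen (x + y) - free_gen x - free_gen y | x y. True} \<union>
    {free_gen (smul c x) - free_const c * free_gen x | c x. True} \<union>
    {free_gen x * free_gen y - free_gen y * free_gen x - free_gen (bracket x y) | x y. True}"

definition uea_ideal ::
  "('k::field \<Rightarrow> 'g::ab_group_add \<Rightarrow> 'g) \<Rightarrow> ('g \<Rightarrow> 'g \<Rightarrow> 'g) \<Rightarrow> ('g word \<Rightarrow>\<^sub>0 'k) set"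
  where "uea_ideal smul bracket = genideal free_algebra (uea_relations smul bracket)"

definition uea ::
  "('k::field \<Rightarrow> 'g::ab_group_add \<Rightarrow> 'g) \<Rightarrow> ('g \<Rightarrow> 'g \<Rightarrow> 'g) \<Rightarrow> ('g word \<Rightarrow>\<^sub>0 'k) set ring"
  where "uea smul bracket = FactRing free_algebra (uea_ideal smul bracket)"

definition uea_class ::
  "('k::field \<Rightarrow> 'g::ab_group_add \<Rightarrow> 'g) \<Rightarrow> ('g \<Rightarrow> 'g \<Rightarrow> 'g) \<Rightarrow>
   ('g word \<Rightarrow>\<^sub>0 'k) \<Rightarrow> ('g word \<Rightarrow>\<^sub>0 'k) set"
  where "uea_class smul bracket p = uea_ideal smul bracket +>\<^bsub>free_algebra\<^esub> p"

definition uea_embed ::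
  "('k::field \<Rightarrow> 'g::ab_group_add \<Rightarrow> 'g) \<Rightarrow> ('g \<Rightarrow> 'g \<Rightarrow> 'g) \<Rightarrow> 'g \<Rightarrow> ('g word \<Rightarrow>\<^sub>0 'k) set"
  where "uea_embed smul bracket x = uea_class smul bracket (free_gen x)"

definition uea_scale ::
  "('k::field \<Rightarrow> 'g::ab_group_add \<Rightarrow> 'g) \<Rightarrow> ('g \<Rightarrow> 'g \<Rightarrow> 'g) \<Rightarrow>
   'k \<Rightarrow> ('g word \<Rightarrow>\<^sub>0 'k) set \<Rightarrow> ('g word \<Rightarrow>\<^sub>0 'k) set"
  where "uea_scale smul bracket c X =
    uea_class smul bracket (free_const c) \<otimes>\<^bsub>uea smul bracket\<^esub> X"

text \<open>Membership in \<^const>\<open>ring_hom\<close> includes preservation of the unit.\<close>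

definition uea_hom ::
  "('k::field \<Rightarrow> 'g::ab_group_add \<Rightarrow> 'g) \<Rightarrow> ('g \<Rightarrow> 'g \<Rightarrow> 'g) \<Rightarrow>
   ('k \<Rightarrow> 'h::ab_group_add \<Rightarrow> 'h) \<Rightarrow> ('h \<Rightarrow> 'h \<Rightarrow> 'h) \<Rightarrow>
   (('g word \<Rightarrow>\<^sub>0 'k) set \<Rightarrow> ('h word \<Rightarrow>\<^sub>0 'k) set) \<Rightarrow> bool"
  where "uea_hom s br s' br' F \<longleftrightarrow>
    F \<in> ring_hom (uea s br) (uea s' br') \<and>
    (\<forall>c. \<forall>X \<in> carrier (uea s br). F (uea_scale s br c X) = uea_scale s' br' c (F X))"

lemma ring_free_algebra: "Ring.ring (free_algebra :: ('g word \<Rightarrow>\<^sub>0 'k::field) ring)"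
proof -
  have "\<exists>y. y + x = 0 \<and> x + y = 0" for x :: "'g word \<Rightarrow>\<^sub>0 'k"
    by (rule exI [of _ "- x"]) simp
  then show ?thesis
    unfolding free_algebra_def
    by unfold_locales (auto simp: Units_def algebra_simps)
qed

lemma ideal_uea_ideal: "ideal (uea_ideal s br) free_algebra"
  unfolding uea_ideal_def
  by (rule ring.genideal_ideal [OF ring_free_algebra]) (simp add: free_algebra_def)

lemma ring_uea: "Ring.ring (uea s br)"
  unfolding uea_def by (rule ideal.quotient_is_ring [OF ideal_uea_ideal])

section \<open>Formal series in the inverses of u and v\<close>

text \<open>A series in $u^{-1}$ is given by its coefficients: \<open>F n\<close> is the coefficient at $u^{-n}$.
  Similarly \<open>F a b\<close> is the coefficient at $u^{-a} v^{-b}$. Integer indices allow for finitely many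
  positive powers, which arise from multiplication by $u$ or $v$.\<close>

type_synonym 'a series = "int \<Rightarrow> 'a"
type_synonym 'a series2 = "int \<Rightarrow> int \<Rightarrow> 'a"

definition in_u :: "'a::zero series \<Rightarrow> 'a series2"
  where "in_u F = (\<lambda>a b. if b = 0 then F a else 0)"

definition in_v :: "'a::zero series \<Rightarrow> 'a series2"
  where "in_v F = (\<lambda>a b. if a = 0 then F b else 0)"

definition mult_u :: "'a series2 \<Rightarrow> 'a series2"
  where "mult_u F = (\<lambda>a b. F (a + 1) b)"

definition mult_v :: "'a series2 \<Rightarrow> 'a series2"
  where "mult_v F = (\<lambda>a b. F a (b + 1))"

definition diff2 :: "'a::ab_group_add series2 \<Rightarrow> 'a series2 \<Rightarrow> 'a series2"
  where "diff2 F G = (\<lambda>a b. F a b - G a b)"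

definition inverse_powers :: "'a::zero series2 \<Rightarrow> bool"
  where "inverse_powers Q \<longleftrightarrow> (\<forall>a b. a < 0 \<or> b < 0 \<longrightarrow> Q a b = 0)"

text \<open>The quotient $F / (u - v)$ is the power series $Q$ in $u^{-1}, v^{-1}$ with
  $(u - v) Q = F$. There is at most one such $Q$, because multiplication by $u - v$ is injective
  on these series.\<close>

definition div_u_minus_v :: "'a::ab_group_add series2 \<Rightarrow> 'a series2"
  where "div_u_minus_v F = (THE Q. inverse_powers Q \<and> diff2 (mult_u Q) (mult_v Q) = F)"

lemma quotient_unique:
  assumes "inverse_powers Q" "inverse_powers Q'"
    and "diff2 (mult_u Q) (mult_v Q) = diff2 (mult_u Q') (mult_v Q')"
  shows "Q = Q'"
proof -
  have step: "Q (a + 1) b - Q a (b + 1) = Q' (a + 1) b - Q' a (b + 1)" for a b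
    using fun_cong [OF fun_cong [OF assms(3), of a], of b]
    by (simp add: diff2_def mult_u_def mult_v_def)
  have "Q (int n - 1) b = Q' (int n - 1) b" for n b
  proof (induction n arbitrary: b)
    case 0
    then show ?case using assms(1,2) by (simp add: inverse_powers_def)
  next
    case (Suc n)
    show ?case using step [of "int n - 1" b] Suc.IH [of "b + 1"] by simp
  qed
  then have *: "Q (int n - 1) b = Q' (int n - 1) b" for n b .
  show ?thesis
  proof (intro ext)
    fix a b
    show "Q a b = Q' a b"
    proof (cases "a < 0")
      case True
      then show ?thesis using assms(1,2) by (simp add: inverse_powers_def)
    next
      case False
      then show ?thesis using * [of "nat (a + 1)" b] by simp
    qed
  qed
qed

lemma div_u_minus_v_eqI:
  assumes "inverse_powers Q" "diff2 (mult_u Q) (mult_v Q) = F"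
  shows "div_u_minus_v F = Q"
  unfolding div_u_minus_v_def
  using assms quotient_unique by (intro the_equality) auto

lemma div_u_minus_v_divided_difference:
  fixes F :: "'a::ab_group_add series"
  assumes F: "\<And>n. n < 1 \<Longrightarrow> F n = 0"
  shows "div_u_minus_v (diff2 (mult_u (in_u F)) (mult_v (in_v F)))
    = (\<lambda>a b. if a \<ge> 1 \<and> b \<ge> 1 then - F (a + b) else 0)"
proof (rule div_u_minus_v_eqI)
  show "inverse_powers (\<lambda>a b. if a \<ge> 1 \<and> b \<ge> 1 then - F (a + b) else 0)"
    by (simp add: inverse_powers_def)
  show "diff2 (mult_u (\<lambda>a b. if a \<ge> 1 \<and> b \<ge> 1 then - F (a + b) else 0))
      (mult_v (\<lambda>a b. if a \<ge> 1 \<and> b \<ge> 1 then - F (a + b) else 0)) =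
    diff2 (mult_u (in_u F)) (mult_v (in_v F))"
    by (intro ext) (auto simp: diff2_def mult_u_def mult_v_def in_u_def in_v_def F algebra_simps)
qed

section \<open>Matrices\<close>

text \<open>\<open>A $ i $ j\<close> is the entry in row $i$ and column $j$. Matrices acting on $V \otimes V$ are
  indexed by pairs, and \<open>flip\<close> maps $x \otimes y$ to $y \otimes x$.\<close>

definition flip :: "'k::zero_neq_one^('n::finite \<times> 'n)^('n \<times> 'n)"
  where "flip = (\<chi> p q. if fst p = snd q \<and> snd p = fst q then 1 else 0)"

definition tensor_id :: "'a::zero^'n^'n \<Rightarrow> 'a^('n::finite \<times> 'n)^('n \<times> 'n)"
  where "tensor_id A = (\<chi> p q. if snd p = snd q then A $ fst p $ fst q else 0)"

definition id_tensor :: "'a::zero^'n^'n \<Rightarrow> 'a^('n::finite \<times> 'n)^('n \<times> 'n)"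
  where "id_tensor A = (\<chi> p q. if fst p = fst q then A $ snd p $ snd q else 0)"

text \<open>Commutator of a scalar matrix with a matrix over a vector space.\<close>

definition scalar_commutator ::
  "('k \<Rightarrow> 'g \<Rightarrow> 'g) \<Rightarrow> 'k^'n^'n \<Rightarrow> 'g^'n^'n \<Rightarrow> 'g::ab_group_add^'n::finite^'n"
  where "scalar_commutator smul P A =
    (\<chi> p q. (\<Sum>r\<in>UNIV. smul (P $ p $ r) (A $ r $ q)) - (\<Sum>r\<in>UNIV. smul (P $ r $ q) (A $ p $ r)))"

text \<open>The matrix $[A \otimes I, I \otimes B]$ for \<open>A\<close> and \<open>B\<close> with entries in a Lie algebra: its
  entry in row $(i,r)$ and column $(j,s)$ is $[a_i^j, b_r^s]$. The lemma identifies it with the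
  commutator of matrices if the entries belong to an associative algebra.\<close>

definition tensor_bracket ::
  "('g \<Rightarrow> 'g \<Rightarrow> 'g) \<Rightarrow> 'g^'n^'n \<Rightarrow> 'g^'n^'n \<Rightarrow> 'g^('n::finite \<times> 'n)^('n \<times> 'n)"
  where "tensor_bracket bracket A B =
    (\<chi> p q. bracket (A $ fst p $ fst q) (B $ snd p $ snd q))"

lemma tensor_bracket_associative:
  fixes A B :: "'a::ring_1^'n^'n::finite"
  shows "tensor_bracket (\<lambda>x y. x * y - y * x) A B =
    tensor_id A ** id_tensor B - id_tensor B ** tensor_id A"
proof -
  have 1: "(tensor_id A ** id_tensor B) $ (i, r) $ (j, s) = A $ i $ j * B $ r $ s" for i r j s
  proof -
    have "(tensor_id A ** id_tensor B) $ (i, r) $ (j, s) =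
        (\<Sum>c\<in>UNIV. if c = (j, r) then A $ i $ j * B $ r $ s else 0)"
      by (simp only: matrix_matrix_mult_def tensor_id_def id_tensor_def vec_lambda_beta)
        (rule sum.cong, auto)
    then show ?thesis by simp
  qed
  have 2: "(id_tensor B ** tensor_id A) $ (i, r) $ (j, s) = B $ r $ s * A $ i $ j" for i r j s
  proof -
    have "(id_tensor B ** tensor_id A) $ (i, r) $ (j, s) =
        (\<Sum>c\<in>UNIV. if c = (i, s) then B $ r $ s * A $ i $ j else 0)"
      by (simp only: matrix_matrix_mult_def tensor_id_def id_tensor_def vec_lambda_beta)
        (rule sum.cong, auto)
    then show ?thesis by simp
  qed
  show ?thesis
    by (auto simp: vec_eq_iff tensor_bracket_def 1 2)
qed

section \<open>The trigonometric Lie algebra and sums of copies of gl(N)\<close>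

text \<open>The generating series of $L[1], L[2], \ldots$; the value \<open>L 0\<close> is not used.\<close>

definition gen_series :: "(nat \<Rightarrow> 'a::zero) \<Rightarrow> 'a series"
  where "gen_series L = (\<lambda>n. if n \<ge> 1 then L (nat n) else 0)"

locale trig_lie_algebra = lie_algebra smul bracket
  for smul :: "'k::field \<Rightarrow> 'g::ab_group_add \<Rightarrow> 'g" and bracket +
  fixes L :: "nat \<Rightarrow> 'g^'n::finite^'n"
  assumes L_basis: "basis_family (\<lambda>(k, i, j). L k $ i $ j) ({1..} \<times> UNIV \<times> UNIV)"
    and L_bracket: "tensor_bracket bracket (gen_series L a) (gen_series L b) =
      scalar_commutator smul flip
        (div_u_minus_v
          (diff2 (mult_u (in_u (\<lambda>n. tensor_id (gen_series L n))))
                 (mult_v (in_v (\<lambda>n. tensor_id (gen_series L n))))) a b)"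

text \<open>The structure constants determined by the identity of generating series.\<close>

lemma generating_identity_iff:
  fixes L :: "nat \<Rightarrow> 'g::ab_group_add^'n::finite^'n"
  assumes "lie_algebra smul bracket"
  shows "(\<forall>a b. tensor_bracket bracket (gen_series L a) (gen_series L b) =
      scalar_commutator smul flip
        (div_u_minus_v
          (diff2 (mult_u (in_u (\<lambda>n. tensor_id (gen_series L n))))
                 (mult_v (in_v (\<lambda>n. tensor_id (gen_series L n))))) a b)) \<longleftrightarrow>
    (\<forall>p q i j r s. p \<ge> 1 \<longrightarrow> q \<ge> 1 \<longrightarrow> bracket (L p $ i $ j) (L q $ r $ s) =
      (if j = r then L (p + q) $ i $ s else 0) - (if i = s then L (p + q) $ r $ j else 0))"
    (is "(\<forall>a b. ?lhs a b = ?rhs a b) \<longleftrightarrow> ?sc")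
proof -
  interpret lie_algebra smul bracket by fact
  have z: "bracket 0 x = 0" "bracket x 0 = 0" for x
    using bracket_add_left [of 0 0 x] bracket_add_right [of x 0 0] by simp_all
  have d: "div_u_minus_v
      (diff2 (mult_u (in_u (\<lambda>n. tensor_id (gen_series L n))))
             (mult_v (in_v (\<lambda>n. tensor_id (gen_series L n))))) =
    (\<lambda>a b. if a \<ge> 1 \<and> b \<ge> 1 then - tensor_id (gen_series L (a + b)) else 0)"
    by (rule div_u_minus_v_divided_difference)
      (simp add: gen_series_def tensor_id_def vec_eq_iff)
  have c1: "(\<Sum>c\<in>UNIV. smul (flip $ (i, r) $ c) (A $ c $ (j, s))) = A $ (r, i) $ (j, s)"
    for A :: "'g^('n \<times> 'n)^('n \<times> 'n)" and i r j s
  proof -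
    have "(\<Sum>c\<in>UNIV. smul (flip $ (i, r) $ c) (A $ c $ (j, s))) =
        (\<Sum>c\<in>UNIV. if c = (r, i) then A $ (r, i) $ (j, s) else 0)"
      by (rule sum.cong) (auto simp: flip_def)
    then show ?thesis by simp
  qed
  have c2: "(\<Sum>c\<in>UNIV. smul (flip $ c $ (j, s)) (A $ (i, r) $ c)) = A $ (i, r) $ (s, j)"
    for A :: "'g^('n \<times> 'n)^('n \<times> 'n)" and i r j s
  proof -
    have "(\<Sum>c\<in>UNIV. smul (flip $ c $ (j, s)) (A $ (i, r) $ c)) =
        (\<Sum>c\<in>UNIV. if c = (s, j) then A $ (i, r) $ (s, j) else 0)"
      by (rule sum.cong) (auto simp: flip_def)
    then show ?thesis by simp
  qed
  have e: "?rhs a b $ (i, r) $ (j, s) = (if a \<ge> 1 \<and> b \<ge> 1 then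
      (if j = r then L (nat (a + b)) $ i $ s else 0) -
      (if i = s then L (nat (a + b)) $ r $ j else 0) else 0)" for a b i r j s
    unfolding d by (auto simp: scalar_commutator_def c1 c2 tensor_id_def gen_series_def)
  have f: "?lhs a b $ (i, r) $ (j, s) = (if a \<ge> 1 \<and> b \<ge> 1 then
      bracket (L (nat a) $ i $ j) (L (nat b) $ r $ s) else 0)" for a b i r j s
    by (auto simp: tensor_bracket_def gen_series_def z)
  show ?thesis
  proof
    assume *: "\<forall>a b. ?lhs a b = ?rhs a b"
    show ?sc
    proof (intro allI impI)
      fix p q :: nat and i j r s :: 'n
      assume "p \<ge> 1" "q \<ge> 1"
      moreover have "?lhs (int p) (int q) $ (i, r) $ (j, s) = ?rhs (int p) (int q) $ (i, r) $ (j, s)"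
        using * by metis
      ultimately show "bracket (L p $ i $ j) (L q $ r $ s) =
          (if j = r then L (p + q) $ i $ s else 0) - (if i = s then L (p + q) $ r $ j else 0)"
        unfolding e f by (simp add: nat_add_distrib)
    qed
  next
    assume sc: ?sc
    show "\<forall>a b. ?lhs a b = ?rhs a b"
    proof (intro allI)
      fix a b
      have "?lhs a b $ x $ y = ?rhs a b $ x $ y" for x y
      proof (cases "a \<ge> 1 \<and> b \<ge> 1")
        case True
        then have "nat a \<ge> 1" "nat b \<ge> 1" by auto
        with sc have *: "bracket (L (nat a) $ i $ j) (L (nat b) $ r $ s) =
            (if j = r then L (nat a + nat b) $ i $ s else 0) -
            (if i = s then L (nat a + nat b) $ r $ j else 0)" for i j r s
          by blast
        obtain i r j s where [simp]: "x = (i, r)" "y = (j, s)" by (metis surj_pair)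
        show ?thesis
          unfolding \<open>x = (i, r)\<close> \<open>y = (j, s)\<close> e f using True * by (simp add: nat_add_distrib)
      next
        case False
        obtain i r j s where [simp]: "x = (i, r)" "y = (j, s)" by (metis surj_pair)
        show ?thesis
          unfolding \<open>x = (i, r)\<close> \<open>y = (j, s)\<close> e f using False by (simp only: if_not_P if_False)
      qed
      then show "?lhs a b = ?rhs a b"
        by (simp add: vec_eq_iff)
    qed
  qed
qed

text \<open>The family \<open>M 1, \<dots>, M K\<close> generates $gl(N)^{\oplus K}$.\<close>

locale gl_sum = lie_algebra smul bracket
  for smul :: "'k::field \<Rightarrow> 'g::ab_group_add \<Rightarrow> 'g" and bracket +
  fixes K :: nat and M :: "nat \<Rightarrow> 'g^'n::finite^'n"
  assumes M_basis: "basis_family (\<lambda>(k, i, j). M k $ i $ j) ({1..K} \<times> UNIV \<times> UNIV)"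
    and M_bracket: "k \<in> {1..K} \<Longrightarrow> bracket (M k $ i $ j) (M k $ r $ s) =
      (if j = r then M k $ i $ s else 0) - (if i = s then M k $ r $ j else 0)"
    and M_commute: "k \<in> {1..K} \<Longrightarrow> k' \<in> {1..K} \<Longrightarrow> k \<noteq> k' \<Longrightarrow>
      bracket (M k $ i $ j) (M k' $ r $ s) = 0"

text \<open>The coefficient at $u^{-n}$ of $\sum_k M_k u_k / (u - u_k)$. Scalar series in $u^{-1}$ are
  formal Laurent series whose variable \<^const>\<open>fls_X\<close> is $u^{-1}$; thus $u$ is
  \<^const>\<open>fls_X_inv\<close>.\<close>

definition evaluation_series ::
  "('k::field \<Rightarrow> 'g::ab_group_add \<Rightarrow> 'g) \<Rightarrow> nat \<Rightarrow> (nat \<Rightarrow> 'k) \<Rightarrow> (nat \<Rightarrow> 'g^'n::finite^'n) \<Rightarrow>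
   ('g^'n^'n) series"
  where "evaluation_series smul K u M = (\<lambda>n. \<Sum>k = 1..K.
    map_matrix (smul (fls_nth (fls_const (u k) / (fls_X_inv - fls_const (u k))) n)) (M k))"

text \<open>The linear map given on the basis by
  $L(u) \mapsto \sum_k M_k u_k / (u - u_k)$.\<close>

definition is_evaluation ::
  "('k::field \<Rightarrow> 'g::ab_group_add \<Rightarrow> 'g) \<Rightarrow> (nat \<Rightarrow> 'g^'n::finite^'n) \<Rightarrow>
   ('k \<Rightarrow> 'h::ab_group_add \<Rightarrow> 'h) \<Rightarrow> nat \<Rightarrow> (nat \<Rightarrow> 'k) \<Rightarrow> (nat \<Rightarrow> 'h^'n^'n) \<Rightarrow>
   ('g \<Rightarrow> 'h) \<Rightarrow> bool"
  where "is_evaluation smul L smul' K u M \<phi> \<longleftrightarrow>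
    Vector_Spaces.linear smul smul' \<phi> \<and>
    (\<forall>n. map_matrix \<phi> (gen_series L n) = evaluation_series smul' K u M n)"

section \<open>Models\<close>

text \<open>Both locales have models: twisted by the factor $t$, the commutator on
  $gl_N(\mathbb{K}[t])$ gives the trigonometric Lie algebra with \<open>L k $ i $ j\<close> equal to
  $t^{k-1} E_{ij}$, and tuples of matrices give the sum of copies of $gl(N)$.\<close>

lemma (in vector_space) basis_familyI:
  assumes add: "\<And>x v w. d x (v + w) = d x v + d x w"
    and scale: "\<And>x c v. d x (scale c v) = c * d x v"
    and dual: "\<And>x y. x \<in> I \<Longrightarrow> y \<in> I \<Longrightarrow> d x (f y) = (if x = y then 1 else 0)"
    and spans: "\<And>v. v \<in> span (f ` I)"
  shows "basis_family f I"
proof -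
  have inj: "inj_on f I"
    using dual by (metis inj_onI zero_neq_one)
  have zero: "d x 0 = 0" for x
    using scale [of x 0 0] by simp
  have sum: "d x (\<Sum>v\<in>t. g v) = (\<Sum>v\<in>t. d x (g v))" for x t and g :: "'b \<Rightarrow> 'b"
    by (induction t rule: infinite_finite_induct) (simp_all add: zero add)
  have "independent (f ` I)"
    unfolding dependent_explicit
  proof (intro notI, elim exE conjE)
    fix t u
    assume t: "finite t" "t \<subseteq> f ` I" "(\<Sum>v\<in>t. scale (u v) v) = 0" "\<exists>v\<in>t. u v \<noteq> 0"
    then obtain x where x: "x \<in> I" "f x \<in> t" "u (f x) \<noteq> 0" by blast
    have "0 = (\<Sum>v\<in>t. u v * d x v)"
      using sum [of x "\<lambda>v. scale (u v) v" t] t(3) by (simp add: zero scale)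
    also have "\<dots> = (\<Sum>v\<in>t. if v = f x then u (f x) else 0)"
    proof (rule sum.cong)
      fix v assume "v \<in> t"
      then obtain y where "y \<in> I" "v = f y" using t(2) by blast
      then show "u v * d x v = (if v = f x then u (f x) else 0)"
        using dual [OF x(1)] inj x(1) by (auto dest: inj_onD)
    qed simp
    also have "\<dots> = u (f x)" using t(1) x(2) by simp
    finally show False using x(3) by simp
  qed
  with inj spans show ?thesis by (auto simp: basis_family_def)
qed

definition unit_matrix :: "'n \<Rightarrow> 'n \<Rightarrow> 'a::zero \<Rightarrow> 'a^'n^'n::finite"
  where "unit_matrix i j x = (\<chi> a b. if a = i \<and> b = j then x else 0)"

lemma unit_matrix_mult:
  fixes x y :: "'a::semiring_1"
  shows "unit_matrix i j x ** unit_matrix r s y = (if j = r then unit_matrix i s (x * y) else 0)"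
proof -
  have "(\<Sum>c\<in>UNIV. unit_matrix i j x $ a $ c * unit_matrix r s y $ c $ b) =
      (\<Sum>c\<in>UNIV. if c = j then (if a = i \<and> r = j \<and> b = s then x * y else 0) else 0)" for a b
    by (rule sum.cong) (auto simp: unit_matrix_def)
  then show ?thesis
    by (auto simp: matrix_matrix_mult_def vec_eq_iff) (auto simp: unit_matrix_def)
qed

lemma matrix_decompose:
  fixes A :: "'a::comm_monoid_add^'n^'n::finite"
  shows "A = (\<Sum>i\<in>UNIV. \<Sum>j\<in>UNIV. unit_matrix i j (A $ i $ j))"
proof -
  have "(\<Sum>i\<in>UNIV. \<Sum>j\<in>UNIV. unit_matrix i j (A $ i $ j)) $ a $ b = A $ a $ b" for a b
  proof -
    have "(\<Sum>i\<in>UNIV. \<Sum>j\<in>UNIV. unit_matrix i j (A $ i $ j)) $ a $ b =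
        (\<Sum>i\<in>UNIV. \<Sum>j\<in>UNIV. if j = b then (if i = a then A $ a $ b else 0) else 0)"
      by (simp only: sum_component unit_matrix_def vec_lambda_beta) (intro sum.cong refl, auto)
    then show ?thesis by simp
  qed
  then show ?thesis by (simp add: vec_eq_iff)
qed

lemma matrix_diff_distrib:
  fixes A B C :: "'a::comm_ring_1^'n^'n::finite"
  shows "(A + B) ** C = A ** C + B ** C" "(A - B) ** C = A ** C - B ** C"
    "C ** (A + B) = C ** A + C ** B" "C ** (A - B) = C ** A - C ** B"
  by (simp_all add: matrix_matrix_mult_def vec_eq_iff algebra_simps
      flip: sum.distrib sum_subtractf)

lemma matrix_jacobi:
  fixes A B C :: "'a::comm_ring_1^'n^'n::finite"
  shows "A ** (B ** C - C ** B) - (B ** C - C ** B) ** A +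
    (B ** (C ** A - A ** C) - (C ** A - A ** C) ** B) +
    (C ** (A ** B - B ** A) - (A ** B - B ** A) ** C) = 0"
  unfolding matrix_diff_distrib matrix_mul_assoc by simp

lemma trig_lie_algebra_exists:
  "\<exists>smul br (L :: nat \<Rightarrow> ('k::field poly^'n^'n)^'n^'n::finite).
    trig_lie_algebra (smul :: 'k \<Rightarrow> _ \<Rightarrow> _) br L"
proof -
  define sm :: "'k \<Rightarrow> 'k poly^'n^'n \<Rightarrow> 'k poly^'n^'n" where "sm c A = map_matrix (smult c) A" for c A
  define tm :: "'k poly^'n^'n \<Rightarrow> 'k poly^'n^'n" where "tm A = map_matrix (pCons 0) A" for A
  define br where "br A B = tm (A ** B - B ** A)" for A B
  define L :: "nat \<Rightarrow> ('k poly^'n^'n)^'n^'n"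
    where "L k = (\<chi> i j. unit_matrix i j (monom 1 (k - 1)))" for k
  have tm_add: "tm (A + B) = tm A + tm B" and tm_diff: "tm (A - B) = tm A - tm B" for A B
    by (simp_all add: tm_def vec_eq_iff)
  have tm_mult: "A ** tm B = tm (A ** B)" "tm A ** B = tm (A ** B)" for A B
  proof -
    have *: "tm = map_matrix ((*) [:0, 1:])" by (simp add: tm_def fun_eq_iff vec_eq_iff)
    show "A ** tm B = tm (A ** B)" "tm A ** B = tm (A ** B)"
      unfolding * map_matrix_def matrix_matrix_mult_def
      by (simp_all only: vec_eq_iff vec_lambda_beta sum_distrib_left mult_ac simp_thms)
  qed
  have sm_mult: "A ** sm c B = sm c (A ** B)" "sm c A ** B = sm c (A ** B)"
    and sm_tm: "tm (sm c A) = sm c (tm A)"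
    and sm_diff: "sm c (A - B) = sm c A - sm c B" for A B c
  proof -
    have *: "sm c = map_matrix ((*) [:c:])" by (simp add: sm_def fun_eq_iff vec_eq_iff)
    show "A ** sm c B = sm c (A ** B)" "sm c A ** B = sm c (A ** B)"
      unfolding * map_matrix_def matrix_matrix_mult_def
      by (simp_all only: vec_eq_iff vec_lambda_beta sum_distrib_left mult_ac simp_thms)
    show "tm (sm c A) = sm c (tm A)" "sm c (A - B) = sm c A - sm c B"
      by (simp_all add: tm_def sm_def vec_eq_iff smult_diff_right)
  qed
  interpret vector_space sm
    by unfold_locales (simp_all add: sm_def vec_eq_iff smult_add_right smult_add_left)
  have tm_0: "tm 0 = 0" by (simp add: tm_def vec_eq_iff)
  interpret lie_algebra sm br
  proof unfold_locales
    fix x y z c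
    show "br (x + y) z = br x z + br y z" "br x (y + z) = br x y + br x z" "br x x = 0"
      by (simp_all add: br_def matrix_diff_distrib tm_add tm_diff tm_0)
    show "br (sm c x) y = sm c (br x y)" "br x (sm c y) = sm c (br x y)"
      by (simp_all add: br_def sm_mult sm_tm flip: sm_diff)
    show "br x (br y z) + br y (br z x) + br z (br x y) = 0"
      unfolding br_def tm_mult tm_diff [symmetric] tm_add [symmetric] matrix_jacobi tm_0 ..
  qed
  have L: "L k $ i $ j = unit_matrix i j (monom 1 (k - 1))" for k i j
    by (simp add: L_def)
  have tm_L: "tm (unit_matrix i j (monom 1 m)) = unit_matrix i j (monom 1 (Suc m))" for i j m
    by (simp add: tm_def unit_matrix_def vec_eq_iff monom_Suc)
  have "basis_family (\<lambda>(k, i, j). L k $ i $ j) ({1..} \<times> UNIV \<times> UNIV)"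
  proof (rule basis_familyI [where d = "\<lambda>(k, i, j) A. coeff (A $ i $ j) (k - 1)"])
    fix A
    have "unit_matrix i j p \<in> span ((\<lambda>(k, i, j). L k $ i $ j) ` ({1..} \<times> UNIV \<times> UNIV))"
      (is "_ \<in> span ?B") for i j p
    proof -
      have eq: "unit_matrix i j p = (\<Sum>m\<le>degree p. sm (coeff p m) (L (Suc m) $ i $ j))"
      proof -
        have "unit_matrix i j p = unit_matrix i j (\<Sum>m\<le>degree p. monom (coeff p m) m)"
          by (simp add: poly_as_sum_of_monoms)
        also have "\<dots> = (\<Sum>m\<le>degree p. sm (coeff p m) (L (Suc m) $ i $ j))"
          by (auto simp: L sm_def unit_matrix_def vec_eq_iff smult_monom)
        finally show ?thesis .
      qed
      have mem: "L (Suc m) $ i $ j \<in> ?B" for m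
        by (rule image_eqI [of _ _ "(Suc m, i, j)"]) auto
      show ?thesis
        unfolding eq by (intro span_sum span_scale span_base mem)
    qed
    then show "A \<in> span ((\<lambda>(k, i, j). L k $ i $ j) ` ({1..} \<times> UNIV \<times> UNIV))"
      by (subst matrix_decompose) (intro span_sum)
  qed (auto simp: sm_def L unit_matrix_def split: if_splits)
  moreover have "\<forall>p q i j r s. p \<ge> 1 \<longrightarrow> q \<ge> 1 \<longrightarrow> br (L p $ i $ j) (L q $ r $ s) =
      (if j = r then L (p + q) $ i $ s else 0) - (if i = s then L (p + q) $ r $ j else 0)"
  proof (intro allI impI)
    fix p q :: nat and i j r s :: 'n
    assume "p \<ge> 1" "q \<ge> 1"
    then obtain p' q' where "p = Suc p'" "q = Suc q'"
      by (metis Suc_le_D One_nat_def)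
    then show "br (L p $ i $ j) (L q $ r $ s) =
      (if j = r then L (p + q) $ i $ s else 0) - (if i = s then L (p + q) $ r $ j else 0)"
      by (simp add: br_def L unit_matrix_mult mult_monom tm_diff tm_L tm_0 add.commute)
  qed
  ultimately have "trig_lie_algebra sm br L"
    using generating_identity_iff [OF lie_algebra_axioms, of L] by unfold_locales blast+
  then show ?thesis by blast
qed

lemma gl_sum_exists:
  "\<exists>smul br (M :: nat \<Rightarrow> ('k::field^'n^'n^'m::finite)^'n^'n::finite).
    gl_sum (smul :: 'k \<Rightarrow> _ \<Rightarrow> _) br CARD('m) M"
proof -
  obtain e where e: "bij_betw e {1..CARD('m)} (UNIV :: 'm set)"
    using ex_bij_betw_nat_finite_1 [of "UNIV :: 'm set"] by auto
  define sm :: "'k \<Rightarrow> 'k^'n^'n^'m \<Rightarrow> 'k^'n^'n^'m" where "sm c A = (\<chi> q. map_matrix ((*) c) (A $ q))" for c A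
  define br :: "'k^'n^'n^'m \<Rightarrow> 'k^'n^'n^'m \<Rightarrow> 'k^'n^'n^'m"
    where "br A B = (\<chi> q. A $ q ** B $ q - B $ q ** A $ q)" for A B
  define M :: "nat \<Rightarrow> ('k^'n^'n^'m)^'n^'n"
    where "M k = (\<chi> i j. \<chi> q. if q = e k then unit_matrix i j 1 else 0)" for k
  have sc: "map_matrix ((*) c) A ** B = map_matrix ((*) c) (A ** B)"
    "B ** map_matrix ((*) c) A = map_matrix ((*) c) (B ** A)" for A B :: "'k^'n^'n" and c
    by (simp_all add: matrix_matrix_mult_def vec_eq_iff sum_distrib_left mult_ac)
  interpret vector_space sm
    by unfold_locales (simp_all add: sm_def vec_eq_iff algebra_simps)
  have sc_diff: "map_matrix ((*) c) (A - B) = map_matrix ((*) c) A - map_matrix ((*) c) B"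
    for A B :: "'k^'n^'n" and c
    by (simp add: vec_eq_iff algebra_simps)
  interpret lie_algebra sm br
  proof unfold_locales
    fix x y z c
    show "br (x + y) z = br x z + br y z" "br x (y + z) = br x y + br x z" "br x x = 0"
      by (simp_all add: br_def vec_eq_iff [where 'b = 'm] matrix_diff_distrib)
    show "br (sm c x) y = sm c (br x y)" "br x (sm c y) = sm c (br x y)"
      by (simp_all add: br_def sm_def vec_eq_iff [where 'b = 'm] sc sc_diff)
    show "br x (br y z) + br y (br z x) + br z (br x y) = 0"
      by (simp add: br_def vec_eq_iff [where 'b = 'm] matrix_jacobi)
  qed
  have M: "M k $ i $ j = (\<chi> q. if q = e k then unit_matrix i j 1 else 0)" for k i j
    by (simp add: M_def)
  have inj: "e k = e k' \<longleftrightarrow> k = k'" if "k \<in> {1..CARD('m)}" "k' \<in> {1..CARD('m)}" for k k'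
    by (rule inj_on_eq_iff [OF bij_betw_imp_inj_on [OF e] that])
  have "basis_family (\<lambda>(k, i, j). M k $ i $ j) ({1..CARD('m)} \<times> UNIV \<times> UNIV)"
  proof (rule basis_familyI [where d = "\<lambda>(k, i, j) A. A $ e k $ i $ j"])
    fix A
    let ?S = "span ((\<lambda>(k, i, j). M k $ i $ j) ` ({1..CARD('m)} \<times> UNIV \<times> UNIV))"
    have "A = (\<Sum>k = 1..CARD('m). \<Sum>i\<in>UNIV. \<Sum>j\<in>UNIV. sm (A $ e k $ i $ j) (M k $ i $ j))"
    proof -
      have "(\<Sum>k = 1..CARD('m). \<Sum>i\<in>UNIV. \<Sum>j\<in>UNIV. sm (A $ e k $ i $ j) (M k $ i $ j)) $ q = A $ q" for q
      proof -
        obtain k0 where k0: "k0 \<in> {1..CARD('m)}" "q = e k0"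
          using e by (metis UNIV_I bij_betw_imp_surj_on imageE)
        have "(\<Sum>k = 1..CARD('m). \<Sum>i\<in>UNIV. \<Sum>j\<in>UNIV. sm (A $ e k $ i $ j) (M k $ i $ j)) $ q =
            (\<Sum>k = 1..CARD('m). if k = k0 then \<Sum>i\<in>UNIV. \<Sum>j\<in>UNIV. unit_matrix i j (A $ q $ i $ j) else 0)"
          unfolding sum_component
        proof (rule sum.cong)
          fix k assume "k \<in> {1..CARD('m)}"
          then have "q = e k \<longleftrightarrow> k = k0" using inj k0 by metis
          then show "(\<Sum>i\<in>UNIV. \<Sum>j\<in>UNIV. sm (A $ e k $ i $ j) (M k $ i $ j) $ q) =
              (if k = k0 then \<Sum>i\<in>UNIV. \<Sum>j\<in>UNIV. unit_matrix i j (A $ q $ i $ j) else 0)"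
            using k0 by (auto simp: sm_def M vec_eq_iff unit_matrix_def intro!: sum.cong)
        qed simp
        also have "\<dots> = A $ q"
          using k0 by (simp flip: matrix_decompose)
        finally show ?thesis .
      qed
      then show ?thesis by (simp add: vec_eq_iff [where 'b = 'm])
    qed
    moreover have "sm c (M k $ i $ j) \<in> ?S" if "k \<in> {1..CARD('m)}" for c k i j
      by (rule span_scale, rule span_base, rule image_eqI [of _ _ "(k, i, j)"]) (use that in auto)
    then have "(\<Sum>k = 1..CARD('m). \<Sum>i\<in>UNIV. \<Sum>j\<in>UNIV. sm (A $ e k $ i $ j) (M k $ i $ j)) \<in> ?S"
      by (intro span_sum)
    ultimately show "A \<in> ?S" by simp
  qed (auto simp: sm_def M unit_matrix_def inj split: if_splits)
  moreover have "br (M k $ i $ j) (M k $ r $ s) =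
      (if j = r then M k $ i $ s else 0) - (if i = s then M k $ r $ j else 0)" for k i j r s
    by (auto simp: br_def M vec_eq_iff [where 'b = 'm] unit_matrix_mult)
  moreover have "br (M k $ i $ j) (M k' $ r $ s) = 0"
    if "k \<in> {1..CARD('m)}" "k' \<in> {1..CARD('m)}" "k \<noteq> k'" for k k' i j r s
  proof -
    have "0 ** A = 0" "A ** 0 = 0" for A :: "'k^'n^'n"
      by (simp_all add: matrix_matrix_mult_def vec_eq_iff)
    then show ?thesis
      using inj [OF that(1,2)] that(3) by (auto simp: br_def M vec_eq_iff [where 'b = 'm])
  qed
  ultimately have "gl_sum sm br CARD('m) M"
    by unfold_locales
  then show ?thesis by blast
qed

end

theory Submission
  imports Defs
begin

text \<open>
  The coefficient of $c/(u-c)$ at $u^{-p}$ is $c^p$ for $p \ge 1$. Hence the map $\phi$ in question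
  sends the basis element $l_i^j[p]$ to $\sum_k u_k^p (m_k)_i^j$, and being prescribed on a basis,
  it exists and is unique as a linear map. Coefficientwise the defining relation of the
  trigonometric algebra reads
  $[l_i^j[p], l_r^s[q]] = \delta_r^j l_i^s[p+q] - \delta_i^s l_r^j[p+q]$: the algebra is $t \, gl(N)[t]$ with $l_i^j[p] = t^p E_{ij}$, and $\phi$ evaluates a polynomial at
  $t = u_k$ in the $k$-th copy of $gl(N)$. In the target different copies of $gl(N)$ commute, so in
  the bracket of two images only the diagonal terms $k = k'$ survive, with weight
  $u_k^p u_k^q = u_k^{p+q}$. This is the image of the bracket, so $\phi$ is a Lie algebra morphism
  (\<open>bracket_weighted_sums\<close>, \<open>is_evaluation_lie_algebra_hom\<close>).

  The second half is functoriality of the enveloping algebra and holds for every Lie algebra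
  morphism. Renaming letters by $\phi$ is a homomorphism of free algebras that carries defining
  relations to defining relations (\<open>free_map_relations\<close>), so it descends to the quotients
  (\<open>ex_uea_hom\<close>). It is determined by its values on the generators because these generate
  the enveloping algebra as an algebra with unit (\<open>uea_hom_eq_on_carrier\<close>).
\<close>

section \<open>The evaluation map\<close>

text \<open>The geometric series: multiplied by $u - c$, the sum of $c^n u^{-n}$ over $n \ge 1$
  telescopes to $c$.\<close>

lemma fls_geometric_nth:
  fixes c :: "'k::field"
  shows "fls_nth (fls_const c / (fls_X_inv - fls_const c)) n = (if n \<ge> 1 then c ^ nat n else 0)"
proof -
  define G where "G = fps_to_fls (Abs_fps (\<lambda>n. if n = 0 then 0 else c ^ n))"
  have G: "fls_nth G n = (if n \<ge> 1 then c ^ nat n else 0)" for n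
    by (auto simp: G_def)
  \<comment> \<open>Division by zero has the value zero, so the divisor has to be seen to be nonzero.\<close>
  have "fls_nth (fls_X_inv - fls_const c) (- 1) = 1"
    by simp
  then have nonzero: "fls_X_inv - fls_const c \<noteq> 0"
    by force
  have "G * (fls_X_inv - fls_const c) = fls_const c"
  proof (rule fls_eqI)
    fix n
    have "fls_nth (G * (fls_X_inv - fls_const c)) n = fls_nth G (n + 1) - fls_nth G n * c"
      by (simp add: right_diff_distrib fls_X_inv_times_conv_shift)
    moreover have "c ^ nat (n + 1) = c ^ nat n * c" if "n \<ge> 1"
      using that by (simp add: nat_add_distrib)
    ultimately show "fls_nth (G * (fls_X_inv - fls_const c)) n = fls_nth (fls_const c) n"
      by (auto simp: G)
  qed
  then have "fls_const c / (fls_X_inv - fls_const c) = G"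
    using nonzero by (simp add: nonzero_divide_eq_eq)
  then show ?thesis
    by (simp add: G)
qed

lemma evaluation_series_nth:
  fixes M :: "nat \<Rightarrow> 'g::ab_group_add^'n^'n::finite"
  assumes "vector_space smul"
  shows "evaluation_series smul K u M n $ i $ j =
    (if n \<ge> 1 then \<Sum>k = 1..K. smul (u k ^ nat n) (M k $ i $ j) else 0)"
proof -
  interpret vector_space smul by fact
  show ?thesis
    by (simp add: evaluation_series_def fls_geometric_nth)
qed

text \<open>The identity of generating series amounts to its coefficients at $u^{-p}$ with $p \ge 1$,
  since both sides vanish at the other powers of $u$.\<close>

lemma is_evaluation_iff:
  fixes L :: "nat \<Rightarrow> 'g::ab_group_add^'n^'n::finite"
    and M :: "nat \<Rightarrow> 'h::ab_group_add^'n^'n"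
  assumes "vector_space smul'"
  shows "is_evaluation smul L smul' K u M \<phi> \<longleftrightarrow>
    Vector_Spaces.linear smul smul' \<phi> \<and>
    (\<forall>p\<ge>1. \<forall>i j. \<phi> (L p $ i $ j) = (\<Sum>k = 1..K. smul' (u k ^ p) (M k $ i $ j)))"
proof (cases "Vector_Spaces.linear smul smul' \<phi>")
  case True
  then interpret Vector_Spaces.linear smul smul' \<phi> .
  have "(\<forall>n. map_matrix \<phi> (gen_series L n) = evaluation_series smul' K u M n) \<longleftrightarrow>
      (\<forall>n\<ge>1. \<forall>i j. \<phi> (L (nat n) $ i $ j) = (\<Sum>k = 1..K. smul' (u k ^ nat n) (M k $ i $ j)))"
    by (auto simp: vec_eq_iff gen_series_def evaluation_series_nth [OF assms] zero)
  also have "\<dots> \<longleftrightarrow>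
      (\<forall>p\<ge>1. \<forall>i j. \<phi> (L p $ i $ j) = (\<Sum>k = 1..K. smul' (u k ^ p) (M k $ i $ j)))"
    (is "(\<forall>n\<ge>1. ?P (nat n)) = _")
  proof (intro iffI allI impI)
    fix p :: nat assume *: "\<forall>n\<ge>1. ?P (nat n)" "p \<ge> 1"
    show "\<phi> (L p $ i $ j) = (\<Sum>k = 1..K. smul' (u k ^ p) (M k $ i $ j))" for i j
      using *(1) [rule_format, of "int p" i j] *(2) by simp
  qed auto
  finally show ?thesis
    by (simp add: is_evaluation_def True)
qed (simp add: is_evaluation_def)

lemma ex1_linear_on_basis_family:
  assumes "vector_space s" "vector_space s'"
    and basis: "vector_space.basis_family s f I"
  shows "\<exists>!\<phi>. Vector_Spaces.linear s s' \<phi> \<and> (\<forall>x\<in>I. \<phi> (f x) = g x)"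
proof -
  interpret vector_space_pair s s'
    using assms(1,2) by (rule vector_space_pair.intro)
  have inj: "inj_on f I" and ind: "vs1.independent (f ` I)" and span: "vs1.span (f ` I) = UNIV"
    using basis by (auto simp: vs1.basis_family_def)
  obtain \<phi> where \<phi>: "Vector_Spaces.linear s s' \<phi>" "\<forall>b\<in>f ` I. \<phi> b = g (the_inv_into I f b)"
    using linear_independent_extend [OF ind] by meson
  show ?thesis
  proof (rule ex1I [of _ \<phi>])
    show "Vector_Spaces.linear s s' \<phi> \<and> (\<forall>x\<in>I. \<phi> (f x) = g x)"
      using \<phi> by (simp add: the_inv_into_f_f [OF inj])
    fix \<psi> assume \<psi>: "Vector_Spaces.linear s s' \<psi> \<and> (\<forall>x\<in>I. \<psi> (f x) = g x)"
    show "\<psi> = \<phi>"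
    proof
      show "\<psi> x = \<phi> x" for x
        by (rule linear_eq_on [of _ _ _ "f ` I"]) (use \<psi> \<phi> span inj in \<open>auto simp: the_inv_into_f_f\<close>)
    qed
  qed
qed

lemma ex1_is_evaluation:
  assumes "trig_lie_algebra smul br L" and "vector_space smul'"
  shows "\<exists>!\<phi>. is_evaluation smul L smul' K u M \<phi>"
proof -
  interpret trig_lie_algebra smul br L by fact
  have "is_evaluation smul L smul' K u M \<phi> \<longleftrightarrow> Vector_Spaces.linear smul smul' \<phi> \<and>
      (\<forall>x\<in>{1..} \<times> UNIV \<times> UNIV. \<phi> (case x of (p, i, j) \<Rightarrow> L p $ i $ j) =
        (case x of (p, i, j) \<Rightarrow> \<Sum>k = 1..K. smul' (u k ^ p) (M k $ i $ j)))" for \<phi>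
    unfolding is_evaluation_iff [OF assms(2)] by auto
  then show ?thesis
    using ex1_linear_on_basis_family [OF vector_space_axioms assms(2) L_basis] by presburger
qed

text \<open>By bilinearity, compatibility with brackets extends from a spanning set to the whole algebra,
  one argument at a time.\<close>

lemma lie_algebra_homI_span:
  assumes "lie_algebra s br" "lie_algebra s' br'" and lin: "Vector_Spaces.linear s s' \<phi>"
    and span: "module.span s B = UNIV"
    and on_B: "\<And>x y. x \<in> B \<Longrightarrow> y \<in> B \<Longrightarrow> \<phi> (br x y) = br' (\<phi> x) (\<phi> y)"
  shows "lie_algebra_hom s br s' br' \<phi>"
proof -
  interpret G: lie_algebra s br by fact
  interpret H: lie_algebra s' br' by fact
  interpret Vector_Spaces.linear s s' \<phi> by fact
  have z: "br 0 x = 0" "br x 0 = 0" "br' 0 y = 0" "br' y 0 = 0" for x y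
    using G.bracket_add_left [of 0 0 x] G.bracket_add_right [of x 0 0]
      H.bracket_add_left [of 0 0 y] H.bracket_add_right [of y 0 0] by simp_all
  note simps = z add scale zero G.bracket_add_left G.bracket_add_right G.bracket_scale_left
    G.bracket_scale_right H.bracket_add_left H.bracket_add_right H.bracket_scale_left
    H.bracket_scale_right
  have left: "\<phi> (br x y) = br' (\<phi> x) (\<phi> y)" if "y \<in> B" for x y
  proof -
    have "x \<in> G.span B" using span by simp
    then show ?thesis
      by (induction rule: G.span_induct_alt) (simp_all add: simps on_B that)
  qed
  have "\<phi> (br x y) = br' (\<phi> x) (\<phi> y)" for x y
  proof -
    have "y \<in> G.span B" using span by simp
    then show ?thesis
      by (induction rule: G.span_induct_alt) (simp_all add: simps left)
  qed
  then show ?thesis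
    using lin by (simp add: lie_algebra_hom_def)
qed

lemma (in lie_algebra) bracket_sum_left: "bracket (\<Sum>i\<in>A. f i) y = (\<Sum>i\<in>A. bracket (f i) y)"
proof -
  have "bracket 0 y = 0" using bracket_add_left [of 0 0 y] by simp
  then show ?thesis
    by (induction A rule: infinite_finite_induct) (simp_all add: bracket_add_left)
qed

lemma (in lie_algebra) bracket_sum_right: "bracket x (\<Sum>i\<in>A. f i) = (\<Sum>i\<in>A. bracket x (f i))"
proof -
  have "bracket x 0 = 0" using bracket_add_right [of x 0 0] by simp
  then show ?thesis
    by (induction A rule: infinite_finite_induct) (simp_all add: bracket_add_right)
qed

text \<open>The weighted diagonal copies of $gl(N)$ multiply their weights pointwise under the bracket. With
  weights $u_k^p$ and $u_k^q$ this is the additivity of degrees in the trigonometric algebra.\<close>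

lemma (in gl_sum) bracket_weighted_sums:
  "bracket (\<Sum>k = 1..K. smul (a k) (M k $ i $ j)) (\<Sum>k = 1..K. smul (b k) (M k $ r $ s)) =
    (if j = r then \<Sum>k = 1..K. smul (a k * b k) (M k $ i $ s) else 0) -
    (if i = s then \<Sum>k = 1..K. smul (a k * b k) (M k $ r $ j) else 0)"
proof -
  have term_eq: "bracket (smul (a k) (M k $ i $ j)) (smul (b l) (M l $ r $ s)) =
      (if l = k then smul (a k * b k) (bracket (M k $ i $ j) (M k $ r $ s)) else 0)"
    if "k \<in> {1..K}" "l \<in> {1..K}" for k l
    using M_commute [OF that] by (simp add: bracket_scale_left bracket_scale_right)
  have "bracket (\<Sum>k = 1..K. smul (a k) (M k $ i $ j)) (\<Sum>l = 1..K. smul (b l) (M l $ r $ s)) =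
      (\<Sum>k = 1..K. \<Sum>l = 1..K.
        if l = k then smul (a k * b k) (bracket (M k $ i $ j) (M k $ r $ s)) else 0)"
    unfolding bracket_sum_left unfolding bracket_sum_right
    by (intro sum.cong refl term_eq)
  also have "\<dots> = (\<Sum>k = 1..K. (if j = r then smul (a k * b k) (M k $ i $ s) else 0) -
      (if i = s then smul (a k * b k) (M k $ r $ j) else 0))"
    by (rule sum.cong) (simp_all add: M_bracket scale_right_diff_distrib)
  also have "\<dots> = (if j = r then \<Sum>k = 1..K. smul (a k * b k) (M k $ i $ s) else 0) -
      (if i = s then \<Sum>k = 1..K. smul (a k * b k) (M k $ r $ j) else 0)"
    unfolding sum_subtractf by simp
  finally show ?thesis .
qed

lemma (in trig_lie_algebra) structure_constants:
  assumes "p \<ge> 1" "q \<ge> 1"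
  shows "bracket (L p $ i $ j) (L q $ r $ s) =
    (if j = r then L (p + q) $ i $ s else 0) - (if i = s then L (p + q) $ r $ j else 0)"
  using generating_identity_iff [OF lie_algebra_axioms, of L] L_bracket assms by blast

lemma is_evaluation_lie_algebra_hom:
  assumes "trig_lie_algebra smul br L" and "gl_sum smul' br' K M"
    and eval: "is_evaluation smul L smul' K u M \<phi>"
  shows "lie_algebra_hom smul br smul' br' \<phi>"
proof -
  interpret G: trig_lie_algebra smul br L by fact
  interpret H: gl_sum smul' br' K M by fact
  have lin: "Vector_Spaces.linear smul smul' \<phi>"
    and \<phi>: "p \<ge> 1 \<Longrightarrow> \<phi> (L p $ i $ j) = (\<Sum>k = 1..K. smul' (u k ^ p) (M k $ i $ j))" for p i j
    using eval by (auto simp: is_evaluation_iff [OF H.vector_space_axioms])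
  interpret Vector_Spaces.linear smul smul' \<phi> by (fact lin)
  show ?thesis
  proof (rule lie_algebra_homI_span [OF G.lie_algebra_axioms H.lie_algebra_axioms lin])
    show "G.span ((\<lambda>(k, i, j). L k $ i $ j) ` ({1..} \<times> UNIV \<times> UNIV)) = UNIV"
      using G.L_basis by (simp add: G.basis_family_def)
  next
    fix x y
    assume "x \<in> (\<lambda>(k, i, j). L k $ i $ j) ` ({1..} \<times> UNIV \<times> UNIV)"
      and "y \<in> (\<lambda>(k, i, j). L k $ i $ j) ` ({1..} \<times> UNIV \<times> UNIV)"
    then obtain p i j q r s where xy: "x = L p $ i $ j" "y = L q $ r $ s" and pq: "p \<ge> 1" "q \<ge> 1"
      by auto
    have "\<phi> (br x y) =
        (if j = r then \<Sum>k = 1..K. smul' (u k ^ p * u k ^ q) (M k $ i $ s) else 0) -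
        (if i = s then \<Sum>k = 1..K. smul' (u k ^ p * u k ^ q) (M k $ r $ j) else 0)"
      using pq by (simp add: xy G.structure_constants diff zero \<phi> power_add)
    also have "\<dots> = br' (\<phi> x) (\<phi> y)"
      unfolding xy \<phi> [OF pq(1)] \<phi> [OF pq(2)] by (rule H.bracket_weighted_sums [symmetric])
    finally show "\<phi> (br x y) = br' (\<phi> x) (\<phi> y)" .
  qed
qed

section \<open>The free algebra as a functor\<close>

lemma poly_mapping_induct_single [case_names single add]:
  assumes "\<And>w c. P (Poly_Mapping.single w c)" and "\<And>p q. P p \<Longrightarrow> P q \<Longrightarrow> P (p + q)"
  shows "P (p :: 'a \<Rightarrow>\<^sub>0 'b::comm_monoid_add)"
proof (induction p rule: Poly_Mapping.update_induct)
  case const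
  show ?case using assms(1) [of undefined 0] by simp
next
  case (update p a b)
  have "Poly_Mapping.update a b p = p + Poly_Mapping.single a b"
    using update(1) by (intro poly_mapping_eqI)
      (auto simp: lookup_update lookup_add lookup_single in_keys_iff when_def)
  then show ?case using update assms by simp
qed

text \<open>Distinct words may have the same image when the map of letters is not injective; the sum
  collects their coefficients.\<close>

definition free_map :: "('g \<Rightarrow> 'h) \<Rightarrow> ('g word \<Rightarrow>\<^sub>0 'k::field) \<Rightarrow> ('h word \<Rightarrow>\<^sub>0 'k)"
  where "free_map f p = (\<Sum>w\<in>Poly_Mapping.keys p.
    Poly_Mapping.single (map_word f w) (Poly_Mapping.lookup p w))"

text \<open>Summing over a common finite set of words instead of the support makes additivity of
  \<open>free_map\<close> visible.\<close>

lemma free_map_superset: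
  assumes "finite S" "Poly_Mapping.keys p \<subseteq> S"
  shows "free_map f p = (\<Sum>w\<in>S. Poly_Mapping.single (map_word f w) (Poly_Mapping.lookup p w))"
  unfolding free_map_def by (rule sum.mono_neutral_left) (use assms in \<open>auto simp: in_keys_iff\<close>)

lemma free_map_add: "free_map f (p + q) = free_map f p + free_map f q"
proof -
  let ?S = "Poly_Mapping.keys p \<union> Poly_Mapping.keys q"
  have "finite ?S" "Poly_Mapping.keys (p + q) \<subseteq> ?S" "Poly_Mapping.keys p \<subseteq> ?S"
    "Poly_Mapping.keys q \<subseteq> ?S"
    using Poly_Mapping.keys_add [of p q] by auto
  then show ?thesis
    by (simp add: free_map_superset [of ?S] lookup_add single_add sum.distrib)
qed

lemma free_map_diff: "free_map f (p - q) = free_map f p - free_map f q"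
  using free_map_add [of f "p - q" q] by simp

lemma free_map_single:
  "free_map f (Poly_Mapping.single w c) = Poly_Mapping.single (map_word f w) c"
  by (simp add: free_map_def)

lemma map_word_plus: "map_word f (v + w) = map_word f v + map_word f w"
  by (cases v; cases w) (simp add: plus_word_def)

lemma map_word_zero: "map_word f 0 = 0"
  by (simp add: zero_word_def)

lemma free_map_mult: "free_map f (p * q) = free_map f p * free_map f q"
proof (induction p rule: poly_mapping_induct_single)
  case (single v c)
  show ?case
    by (induction q rule: poly_mapping_induct_single)
      (simp_all add: mult_single free_map_single map_word_plus free_map_add distrib_left)
qed (simp add: free_map_add distrib_right)

lemma free_map_const: "free_map f (free_const c) = free_const c"
  by (simp add: free_const_def free_map_single map_word_zero)

lemma free_map_gen: "free_map f (free_gen x) = free_gen (f x)"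
  by (simp add: free_gen_def free_map_single)

lemma free_const_one: "free_const 1 = 1"
  by (simp add: free_const_def)

lemma free_map_ring_hom: "free_map f \<in> ring_hom free_algebra free_algebra"
  using free_map_const [of f 1]
  by (auto simp: ring_hom_def free_algebra_def free_map_add free_map_mult free_const_one)

text \<open>Every monomial arises from a constant by multiplication with letters from the left, so
  constants and letters generate the free algebra.\<close>

lemma free_algebra_induct [case_names const gen_mult add]:
  fixes P :: "('g word \<Rightarrow>\<^sub>0 'k::field) \<Rightarrow> bool"
  assumes const: "\<And>c. P (free_const c)"
    and gen_mult: "\<And>x p. P p \<Longrightarrow> P (free_gen x * p)"
    and add: "\<And>p q. P p \<Longrightarrow> P q \<Longrightarrow> P (p + q)"
  shows "P p"
proof (induction p rule: poly_mapping_induct_single)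
  case (single w c)
  have "P (Poly_Mapping.single (Word xs) c)" for xs
  proof (induction xs)
    case Nil
    show ?case using const [of c] by (simp add: free_const_def zero_word_def)
  next
    case (Cons x xs)
    have "free_gen x * Poly_Mapping.single (Word xs) c = Poly_Mapping.single (Word (x # xs)) c"
      by (simp add: free_gen_def mult_single plus_word_def)
    then show ?case using gen_mult [OF Cons, of x] by simp
  qed
  then show ?case by (cases w) simp
qed (fact add)

section \<open>Functoriality of the enveloping algebra\<close>

text \<open>The universal property of the quotient ring: a homomorphism that kills the ideal is constant
  on its cosets.\<close>

lemma (in ideal) ex_quotient_ring_hom:
  assumes "Ring.ring S" and h: "h \<in> ring_hom R S" and kernel: "\<And>a. a \<in> I \<Longrightarrow> h a = \<zero>\<^bsub>S\<^esub>"
  shows "\<exists>F \<in> ring_hom (R Quot I) S. \<forall>x \<in> carrier R. F (I +> x) = h x"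
proof -
  interpret h: ring_hom_ring R S h
    by (rule ring_hom_ringI2 [OF ring_axioms assms(1) h])
  define F where "F X = the_elem (h ` X)" for X
  have F: "F (I +> x) = h x" if x: "x \<in> carrier R" for x
  proof -
    have "h (a \<oplus> x) = h x" if "a \<in> I" for a
      using that x a_subset kernel [OF that] by (auto simp: h.hom_add)
    then have "h ` (I +> x) = {h x}"
      using a_rcos_self [OF x] by (auto simp: a_r_coset_def')
    then show ?thesis by (simp add: F_def)
  qed
  have carr: "\<exists>x \<in> carrier R. X = I +> x" if "X \<in> carrier (R Quot I)" for X
    using that by (simp add: FactRing_def A_RCOSETS_def')
  have "F \<in> ring_hom (R Quot I) S"
  proof (rule ring_hom_memI)
    fix X assume "X \<in> carrier (R Quot I)"
    then obtain x where x: "x \<in> carrier R" "X = I +> x" using carr by blast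
    show "F X \<in> carrier S" using x by (simp add: F)
    fix Y assume "Y \<in> carrier (R Quot I)"
    then obtain y where y: "y \<in> carrier R" "Y = I +> y" using carr by blast
    show "F (X \<otimes>\<^bsub>R Quot I\<^esub> Y) = F X \<otimes>\<^bsub>S\<^esub> F Y"
      unfolding x(2) y(2) ring_hom_mult [OF rcos_ring_hom x(1) y(1), symmetric] using x(1) y(1) by (simp add: F)
    show "F (X \<oplus>\<^bsub>R Quot I\<^esub> Y) = F X \<oplus>\<^bsub>S\<^esub> F Y"
      unfolding x(2) y(2) ring_hom_add [OF rcos_ring_hom x(1) y(1), symmetric] using x(1) y(1) by (simp add: F)
  next
    show "F \<one>\<^bsub>R Quot I\<^esub> = \<one>\<^bsub>S\<^esub>"
      unfolding ring_hom_one [OF rcos_ring_hom, symmetric] by (simp add: F)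
  qed
  with F show ?thesis by blast
qed

lemma uea_class_ring_hom: "uea_class s br \<in> ring_hom free_algebra (uea s br)"
  using ideal.rcos_ring_hom [OF ideal_uea_ideal]
  by (simp add: uea_class_def [abs_def] uea_def)

lemma carrier_uea: "carrier (uea s br) = range (uea_class s br)"
  by (auto simp: uea_def FactRing_def A_RCOSETS_def' uea_class_def free_algebra_def)

lemma uea_class_mult: "uea_class s br (p * q) = uea_class s br p \<otimes>\<^bsub>uea s br\<^esub> uea_class s br q"
  using ring_hom_mult [OF uea_class_ring_hom, of p q] by (simp add: free_algebra_def)

lemma uea_class_add: "uea_class s br (p + q) = uea_class s br p \<oplus>\<^bsub>uea s br\<^esub> uea_class s br q"
  using ring_hom_add [OF uea_class_ring_hom, of p q] by (simp add: free_algebra_def)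

lemma uea_class_one: "uea_class s br 1 = \<one>\<^bsub>uea s br\<^esub>"
  using ring_hom_one [OF uea_class_ring_hom] by (simp add: free_algebra_def)

lemma uea_scale_class: "uea_scale s br c (uea_class s br p) = uea_class s br (free_const c * p)"
  by (simp add: uea_scale_def uea_class_mult)

lemma uea_class_relation:
  assumes "r \<in> uea_relations s br"
  shows "uea_class s br r = \<zero>\<^bsub>uea s br\<^esub>"
proof -
  interpret ideal "uea_ideal s br" free_algebra by (rule ideal_uea_ideal)
  have "r \<in> uea_ideal s br"
    using assms genideal_self [of "uea_relations s br"]
    by (auto simp: uea_ideal_def free_algebra_def)
  then show ?thesis
    by (simp add: uea_class_def uea_def FactRing_def a_rcos_const)
qed

text \<open>Each of the three kinds of relations is preserved by one property of the morphism:
  additivity, homogeneity, compatibility with brackets.\<close>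

lemma free_map_relations:
  assumes "lie_algebra_hom s br s' br' \<phi>" and "r \<in> uea_relations s br"
  shows "free_map \<phi> r \<in> uea_relations s' br'"
proof -
  interpret Vector_Spaces.linear s s' \<phi> using assms(1) by (simp add: lie_algebra_hom_def)
  have "\<phi> (br x y) = br' (\<phi> x) (\<phi> y)" for x y
    using assms(1) by (simp add: lie_algebra_hom_def)
  note free_map_simps = this free_map_diff free_map_mult free_map_gen free_map_const add scale
  from assms(2) consider
    x y where "r = free_gen (x + y) - free_gen x - free_gen y"
    | c x where "r = free_gen (s c x) - free_const c * free_gen x"
    | x y where "r = free_gen x * free_gen y - free_gen y * free_gen x - free_gen (br x y)"
    unfolding uea_relations_def by blast
  then show ?thesis
    unfolding uea_relations_def by cases (simp_all only: free_map_simps, blast+)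
qed

lemma ex_uea_hom:
  fixes s :: "'k::field \<Rightarrow> 'g::ab_group_add \<Rightarrow> 'g" and s' :: "'k \<Rightarrow> 'h::ab_group_add \<Rightarrow> 'h"
  assumes "lie_algebra_hom s br s' br' \<phi>"
  shows "\<exists>F. uea_hom s br s' br' F \<and> (\<forall>x. F (uea_embed s br x) = uea_embed s' br' (\<phi> x))"
proof -
  define h where "h = uea_class s' br' \<circ> free_map \<phi>"
  have h: "h \<in> ring_hom free_algebra (uea s' br')"
    unfolding h_def by (rule ring_hom_trans [OF free_map_ring_hom uea_class_ring_hom])
  interpret h: ring_hom_ring free_algebra "uea s' br'" h
    by (rule ring_hom_ringI2 [OF ring_free_algebra ring_uea h])
  \<comment> \<open>The kernel is an ideal, so it is enough that it contains the generating relations.\<close>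
  have "uea_ideal s br \<subseteq> a_kernel free_algebra (uea s' br') h"
    unfolding uea_ideal_def
  proof (rule h.R.genideal_minimal [OF h.kernel_is_ideal])
    show "uea_relations s br \<subseteq> a_kernel free_algebra (uea s' br') h"
      using uea_class_relation [OF free_map_relations [OF assms]]
      by (auto simp: a_kernel_def' h_def free_algebra_def)
  qed
  then have "h a = \<zero>\<^bsub>uea s' br'\<^esub>" if "a \<in> uea_ideal s br" for a
    using that unfolding a_kernel_def' by blast
  then obtain F where F: "F \<in> ring_hom (uea s br) (uea s' br')"
    and "\<forall>p \<in> carrier free_algebra. F (uea_ideal s br +>\<^bsub>free_algebra\<^esub> p) = h p"
    using ideal.ex_quotient_ring_hom [OF ideal_uea_ideal ring_uea h, of s br]
    unfolding uea_def by blast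
  then have F_class: "F (uea_class s br p) = uea_class s' br' (free_map \<phi> p)" for p
    by (simp add: uea_class_def h_def free_algebra_def)
  have "uea_hom s br s' br' F"
    using F by (auto simp: uea_hom_def carrier_uea uea_scale_class F_class free_map_mult
        free_map_const)
  moreover have "F (uea_embed s br x) = uea_embed s' br' (\<phi> x)" for x
    by (simp add: uea_embed_def F_class free_map_gen)
  ultimately show ?thesis by blast
qed

text \<open>Two homomorphisms agree on constants because they preserve the unit and scalar
  multiplication; agreement on generators then propagates by \<open>free_algebra_induct\<close>.\<close>

lemma uea_hom_eq_on_carrier:
  assumes F: "uea_hom s br s' br' F" and G: "uea_hom s br s' br' G"
    and gen: "\<And>x. F (uea_embed s br x) = G (uea_embed s br x)"
    and X: "X \<in> carrier (uea s br)"
  shows "F X = G X"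
proof -
  have hom: "F \<in> ring_hom (uea s br) (uea s' br')" "G \<in> ring_hom (uea s br) (uea s' br')"
    using F G by (auto simp: uea_hom_def)
  have "F (uea_class s br p) = G (uea_class s br p)" for p
  proof (induction p rule: free_algebra_induct)
    case (const c)
    have "uea_class s br (free_const c) = uea_scale s br c \<one>\<^bsub>uea s br\<^esub>"
      by (simp add: uea_scale_class flip: uea_class_one)
    moreover have "\<one>\<^bsub>uea s br\<^esub> \<in> carrier (uea s br)"
      by (simp add: carrier_uea flip: uea_class_one)
    ultimately show ?case
      using F G ring_hom_one [OF hom(1)] ring_hom_one [OF hom(2)] by (simp add: uea_hom_def)
  next
    case (gen_mult x p)
    then show ?case
      using gen [of x] ring_hom_mult [OF hom(1)] ring_hom_mult [OF hom(2)]
      by (simp add: uea_class_mult carrier_uea uea_embed_def)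
  next
    case (add p q)
    then show ?case
      using ring_hom_add [OF hom(1)] ring_hom_add [OF hom(2)]
      by (simp add: uea_class_add carrier_uea)
  qed
  then show ?thesis using X by (auto simp: carrier_uea)
qed

text \<open>A homomorphism is determined only on the carrier; restricting it to an extensional function
  makes uniqueness an equality of total functions.\<close>

lemma ex1_uea_hom:
  assumes "lie_algebra_hom s br s' br' \<phi>"
  shows "\<exists>!F. F \<in> extensional (carrier (uea s br)) \<and> uea_hom s br s' br' F \<and>
    (\<forall>x. F (uea_embed s br x) = uea_embed s' br' (\<phi> x))"
proof -
  interpret ring "uea s br" by (rule ring_uea)
  obtain F where F: "uea_hom s br s' br' F" "\<And>x. F (uea_embed s br x) = uea_embed s' br' (\<phi> x)"
    using ex_uea_hom [OF assms] by blast
  define F' where "F' = restrict F (carrier (uea s br))"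
  have eq: "F' X = F X" if "X \<in> carrier (uea s br)" for X
    using that by (simp add: F'_def)
  have embed: "uea_embed s br x \<in> carrier (uea s br)" for x
    by (simp add: carrier_uea uea_embed_def)
  have scale: "uea_scale s br c X \<in> carrier (uea s br)" if "X \<in> carrier (uea s br)" for c X
    using that by (auto simp: carrier_uea uea_scale_class)
  have "F \<in> ring_hom (uea s br) (uea s' br')"
    using F(1) by (simp add: uea_hom_def)
  then have "F' \<in> ring_hom (uea s br) (uea s' br')"
    by (auto simp: ring_hom_def eq)
  then have hom': "uea_hom s br s' br' F'"
    using F(1) by (simp add: uea_hom_def eq scale)
  show ?thesis
  proof (rule ex1I [of _ F'])
    show "F' \<in> extensional (carrier (uea s br)) \<and> uea_hom s br s' br' F' \<and>
        (\<forall>x. F' (uea_embed s br x) = uea_embed s' br' (\<phi> x))"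
      using hom' F(2) by (simp add: eq embed) (simp add: F'_def)
    fix G
    assume "G \<in> extensional (carrier (uea s br)) \<and> uea_hom s br s' br' G \<and>
        (\<forall>x. G (uea_embed s br x) = uea_embed s' br' (\<phi> x))"
    then show "G = F'"
      using uea_hom_eq_on_carrier [OF _ hom', of G] F(2)
      by (intro extensionalityI [of G "carrier (uea s br)"]) (auto simp: eq embed F'_def)
  qed
qed

section \<open>The evaluation morphism\<close>

theorem proposition14:
  fixes smul :: "'k::real_normed_field \<Rightarrow> 'g::ab_group_add \<Rightarrow> 'g"
    and br :: "'g \<Rightarrow> 'g \<Rightarrow> 'g"
    and L :: "nat \<Rightarrow> 'g^'n::finite^'n"
    and smul' :: "'k \<Rightarrow> 'h::ab_group_add \<Rightarrow> 'h"
    and br' :: "'h \<Rightarrow> 'h \<Rightarrow> 'h"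
    and K :: nat
    and M :: "nat \<Rightarrow> 'h^'n^'n"
    and u :: "nat \<Rightarrow> 'k"
  assumes "trig_lie_algebra smul br L"
    and "gl_sum smul' br' K M"
  shows "(\<exists>!\<phi>. is_evaluation smul L smul' K u M \<phi>) \<and>
    (\<forall>\<phi>. is_evaluation smul L smul' K u M \<phi> \<longrightarrow>
      lie_algebra_hom smul br smul' br' \<phi> \<and>
      (\<exists>!\<Phi>. \<Phi> \<in> extensional (carrier (uea smul br)) \<and> uea_hom smul br smul' br' \<Phi> \<and>
        (\<forall>x. \<Phi> (uea_embed smul br x) = uea_embed smul' br' (\<phi> x))))"
proof (intro conjI allI impI)
  interpret gl_sum smul' br' K M by fact
  show "\<exists>!\<phi>. is_evaluation smul L smul' K u M \<phi>"
    by (rule ex1_is_evaluation [OF assms(1) vector_space_axioms])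
next
  fix \<phi> assume "is_evaluation smul L smul' K u M \<phi>"
  then show hom: "lie_algebra_hom smul br smul' br' \<phi>"
    by (rule is_evaluation_lie_algebra_hom [OF assms])
  show "\<exists>!\<Phi>. \<Phi> \<in> extensional (carrier (uea smul br)) \<and> uea_hom smul br smul' br' \<Phi> \<and>
      (\<forall>x. \<Phi> (uea_embed smul br x) = uea_embed smul' br' (\<phi> x))"
    by (rule ex1_uea_hom [OF hom])
qed

end
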